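(* Let $A$ be a finite multiset (or set) of positive integers with $\#A=k$, and let $d$ be a fixed integer with $1\leqslant d<k$. Suppose that $\gcd B=1$ for every $(k-d)$-element multisubset $B\subset A$. Then, for every integer $1\leqslant j\leqslant d$, the sequence $(p_A(n))_{n=0}^\infty$ satisfies the order $j$ Turán inequality at $n$ for all sufficiently large values of $n$.
   Context: For a finite multiset $A=\{a_1,a_2,\ldots,a_k\}$ of positive integers (cardinality $\#A=k$ counted with multiplicity), the $A$-partition function $p_A(n)$ is the number of partitions of $n$ with parts in $A$, where the order of the parts is irrelevant and equal elements of the multiset $A$ are regarded as distinguishable (differently coloured) parts. Equivalently, $p_A(n)$ is given by the generating function $$\sum_{n=0}^\infty p_A(n)x^n=\prod_{i=1}^k\frac{1}{1-x^{a_i}}.$$ A $(k-d)$-element multisubset of $A$ is a multiset $\{a_i : i\in I\}$ with $I\subset\{1,\ldots,k\}$, $\#I=k-d$, and $\gcd B$ is the greatest common divisor of all elements of $B$ (so the gcd of a one-element multiset is its element). For a sequence $\omega=(\omega_i)_{i=0}^\infty$ of real numbers, the Jensen polynomial of degree $d$ and shift $n$ associated to $\omega$ is $$J_\omega^{d,n}(x):=\sum_{i=0}^d\binom{d}{i}\omega_{n+i}x^i.$$ A polynomial with real coefficients is called hyperbolic if all of its (complex) roots are real. The sequence $\omega$ satisfies the order $d$ Turán inequality at $n$ if and only if $J_\omega^{d,n}(x)$ is hyperbolic. *)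

theory Defs
  imports "HOL-Computational_Algebra.Computational_Algebra"
begin

text \<open>
  An element \<open>a\<close> of the multiset \<open>A\<close> yields \<open>count A a\<close> differently coloured parts of
  size \<open>a\<close>; the pair \<open>(a, c)\<close> is the part of size \<open>a\<close> with colour \<open>c\<close>.
\<close>

definition coloured_parts :: "nat multiset \<Rightarrow> (nat \<times> nat) set" where
  "coloured_parts A = {(a, c). c < count A a}"

definition partitions_with_parts :: "(nat \<times> nat) set \<Rightarrow> nat \<Rightarrow> (nat \<times> nat) multiset set" where
  "partitions_with_parts S n = {P. set_mset P \<subseteq> S \<and> (\<Sum>x\<in>#P. fst x) = n}"

text \<open>
  This is meaningful only if all elements of \<open>A\<close> are positive; otherwise the set of partitions
  is infinite and the value is \<open>0\<close> by the convention on \<^const>\<open>card\<close>.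
\<close>

definition partition_fun :: "nat multiset \<Rightarrow> nat \<Rightarrow> nat" where
  "partition_fun A n = card (partitions_with_parts (coloured_parts A) n)"

definition jensen_poly :: "(nat \<Rightarrow> real) \<Rightarrow> nat \<Rightarrow> nat \<Rightarrow> real poly" where
  "jensen_poly \<omega> d n = (\<Sum>i\<le>d. monom (real (d choose i) * \<omega> (n + i)) i)"

definition hyperbolic :: "real poly \<Rightarrow> bool" where
  "hyperbolic p \<longleftrightarrow> (\<forall>z::complex. poly (map_poly of_real p) z = 0 \<longrightarrow> z \<in> \<real>)"

definition turan_inequality :: "(nat \<Rightarrow> real) \<Rightarrow> nat \<Rightarrow> nat \<Rightarrow> bool" where
  "turan_inequality \<omega> d n \<longleftrightarrow> hyperbolic (jensen_poly \<omega> d n)"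


lemma partitions_with_parts_empty:
  "partitions_with_parts {} n = (if n = 0 then {{#}} else {})"
  by (auto simp: partitions_with_parts_def)

lemma partitions_with_parts_insert:
  assumes "x \<notin> S"
  shows "partitions_with_parts (insert x S) n =
    partitions_with_parts S n \<union>
    (if fst x \<le> n then add_mset x ` partitions_with_parts (insert x S) (n - fst x) else {})"
    (is "?L = ?R")
proof (intro equalityI subsetI)
  fix P assume P: "P \<in> ?L"
  show "P \<in> ?R"
  proof (cases "x \<in># P")
    case True
    then obtain Q where "P = add_mset x Q" by (meson multi_member_split)
    with P show ?thesis by (auto simp: partitions_with_parts_def)
  next
    case False
    with P show ?thesis by (auto simp: partitions_with_parts_def)
  qed
next
  fix P assume "P \<in> ?R"
  then show "P \<in> ?L" by (auto simp: partitions_with_parts_def split: if_splits)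
qed

lemma finite_partitions_with_parts:
  assumes "finite S" "\<And>x. x \<in> S \<Longrightarrow> fst x > 0"
  shows "finite (partitions_with_parts S n)"
  using assms
proof (induction S arbitrary: n rule: finite_induct)
  case empty
  show ?case by (simp add: partitions_with_parts_empty)
next
  case (insert x S)
  show ?case
  proof (induction n rule: less_induct)
    case (less n)
    have "fst x > 0" using insert.prems by simp
    then have "finite (partitions_with_parts (insert x S) (n - fst x))" if "fst x \<le> n"
      using less[of "n - fst x"] that by simp
    moreover have "finite (partitions_with_parts S n)"
      using insert.IH insert.prems by simp
    ultimately show ?case
      by (subst partitions_with_parts_insert[OF insert.hyps(2)]) simp
  qed
qed

lemma card_partitions_with_parts_insert:
  assumes "finite S" "x \<notin> S" "\<And>y. y \<in> insert x S \<Longrightarrow> fst y > 0"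
  shows "card (partitions_with_parts (insert x S) n) = card (partitions_with_parts S n) +
    (if fst x \<le> n then card (partitions_with_parts (insert x S) (n - fst x)) else 0)"
proof -
  let ?I = "if fst x \<le> n then add_mset x ` partitions_with_parts (insert x S) (n - fst x) else {}"
  have "card (partitions_with_parts (insert x S) n) = card (partitions_with_parts S n) + card ?I"
  proof (subst partitions_with_parts_insert[OF assms(2)], rule card_Un_disjoint)
    show "finite (partitions_with_parts S n)"
      using assms by (intro finite_partitions_with_parts) auto
    have "finite (partitions_with_parts (insert x S) (n - fst x))"
      using assms by (intro finite_partitions_with_parts) auto
    then show "finite ?I" by simp
    show "partitions_with_parts S n \<inter> ?I = {}"
    proof -
      have "x \<notin># P" if "P \<in> partitions_with_parts S n" for P
        using that assms(2) by (auto simp: partitions_with_parts_def)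
      moreover have "x \<in># P" if "P \<in> ?I" for P
        using that by (auto split: if_splits)
      ultimately show ?thesis by blast
    qed
  qed
  also have "card ?I =
      (if fst x \<le> n then card (partitions_with_parts (insert x S) (n - fst x)) else 0)"
    by (simp add: card_image inj_on_def)
  finally show ?thesis .
qed

lemma partitions_with_parts_gf:
  assumes "finite S" "\<And>x. x \<in> S \<Longrightarrow> fst x > 0"
  shows "Abs_fps (\<lambda>n. real (card (partitions_with_parts S n))) =
    (\<Prod>x\<in>S. inverse (1 - fps_X ^ fst x))"
  using assms
proof (induction S rule: finite_induct)
  case empty
  show ?case by (auto simp: partitions_with_parts_empty fps_eq_iff)
next
  case (insert x S)
  let ?F = "\<lambda>S. Abs_fps (\<lambda>n. real (card (partitions_with_parts S n)))"
  let ?g = "1 - fps_X ^ fst x :: real fps"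
  have x: "fst x > 0" using insert.prems by simp
  have "?F (insert x S) = ?F S + fps_X ^ fst x * ?F (insert x S)"
  proof (rule fps_ext)
    fix n
    show "?F (insert x S) $ n = (?F S + fps_X ^ fst x * ?F (insert x S)) $ n"
      using card_partitions_with_parts_insert[OF insert.hyps insert.prems, of n]
      by (simp add: fps_X_power_mult_nth)
  qed
  then have F: "?F S = ?F (insert x S) * ?g" by (simp add: algebra_simps)
  have g: "?g * inverse ?g = 1"
    using x by (intro inverse_mult_eq_1') (simp add: fps_X_power_nth)
  have "?F (insert x S) = ?F S * inverse ?g"
    unfolding F mult.assoc g by simp
  also have "\<dots> = (\<Prod>y\<in>insert x S. inverse (1 - fps_X ^ fst y))"
    using insert by simp
  finally show ?case .
qed

lemma coloured_parts_in:
  assumes "x \<in> coloured_parts A"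
  shows "fst x \<in># A"
proof (rule ccontr)
  assume "fst x \<notin># A"
  then have "count A (fst x) = 0" by (simp only: not_in_iff)
  with assms show False by (auto simp: coloured_parts_def)
qed

lemma finite_coloured_parts: "finite (coloured_parts A)"
proof (rule finite_subset)
  show "coloured_parts A \<subseteq> set_mset A \<times> {..<size A}"
  proof
    fix y assume "y \<in> coloured_parts A"
    then obtain a c where y: "y = (a, c)" "c < count A a"
      by (auto simp: coloured_parts_def)
    have "a \<in># A" using coloured_parts_in[OF \<open>y \<in> coloured_parts A\<close>] y by simp
    then show "y \<in> set_mset A \<times> {..<size A}"
      using y count_le_size[of A a] by simp
  qed
qed simp

lemma coloured_parts_add_mset:
  "coloured_parts (add_mset a A) = insert (a, count A a) (coloured_parts A)"
  by (auto simp: coloured_parts_def split: if_splits)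

text \<open>The generating function of \<^const>\<open>partition_fun\<close>.\<close>

theorem partition_fun_gf:
  assumes "\<forall>a\<in>#A. 0 < a"
  shows "Abs_fps (\<lambda>n. real (partition_fun A n)) = (\<Prod>a\<in>#A. inverse (1 - fps_X ^ a))"
proof -
  have "(\<Prod>x\<in>coloured_parts A. inverse (1 - fps_X ^ fst x :: real fps)) =
      (\<Prod>a\<in>#A. inverse (1 - fps_X ^ a))"
  proof (induction A)
    case empty
    show ?case by (simp add: coloured_parts_def)
  next
    case (add a A)
    have "(a, count A a) \<notin> coloured_parts A" by (simp add: coloured_parts_def)
    with add show ?case by (simp add: coloured_parts_add_mset finite_coloured_parts)
  qed
  moreover have "fst x > 0" if "x \<in> coloured_parts A" for x
    using assms coloured_parts_in[OF that] by blast
  ultimately show ?thesis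
    unfolding partition_fun_def
    using partitions_with_parts_gf[OF finite_coloured_parts, of A] by simp
qed

end

theory Submission
  imports Defs "HOL-Computational_Algebra.Field_as_Ring"
begin

text \<open>
  Write \<open>p\<close> for the partition function of \<open>A\<close>, \<open>\<Delta>\<close> for the forward difference and \<open>K = k - 1\<close>.

  Among the poles of \<open>\<Prod>a\<in>#A. 1 / (1 - x ^ a)\<close>, the point \<open>1\<close> has order \<open>k\<close>. A root of
  unity \<open>\<zeta> \<noteq> 1\<close> of order \<open>m\<close> has as pole order the number of \<open>a\<in>#A\<close> divisible by \<open>m\<close>, and
  the gcd condition makes this number less than \<open>k - d\<close>. Hence \<open>p\<close> is the sum of a polynomial of
  degree \<open>K\<close> with leading coefficient \<open>1 / (K! * prod_mset A)\<close> and of a perturbation with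
  oscillating coefficients, which grows at most like \<open>n ^ (k - d - 2)\<close> and is absent if \<open>k = d + 1\<close>.
  This is too little to affect the leading behaviour of differences up to order \<open>d\<close>:
  \<open>(\<Delta> ^^ i) p n / n ^ (K - i) \<longlonglongrightarrow> 1 / (prod_mset A * (K - i)!)\<close> for \<open>i \<le> d\<close>
  (\<open>partition_fun_difference_asymptotic\<close>). The proof avoids partial fractions. Cancelling
  \<open>(1 - x) ^ i\<close> leaves a pole at \<open>1\<close> of order \<open>s + 1\<close>, with \<open>s = K - i\<close>, and all other poles
  have order at most \<open>s\<close>, so for a common multiple \<open>N\<close> of the parts the function
  becomes \<open>T(x) / ((1 - x) * (1 - x ^ N) ^ s)\<close> with a polynomial \<open>T\<close>
  (\<open>prod_geometric_sums_dvd_power\<close>). The expansion of \<open>1 / ((1 - x) * (1 - x ^ N) ^ s)\<close>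
  has the binomial coefficients \<open>(n div N + s) choose s\<close>, whose growth is elementary.

  Since the shift operator is \<open>1 + \<Delta>\<close>, the Jensen polynomial satisfies
  \<open>J(x) = (\<Sum>i\<le>j. (j choose i) * (1 + x) ^ (j - i) * x ^ i * (\<Delta> ^^ i) p n)\<close>. Substitute
  \<open>x = - n / (y + n)\<close>, that is \<open>1 + x = - x * y / n\<close>. After a rescaling, the values of \<open>J\<close>
  converge to those of \<open>\<Sum>i\<le>j. (j choose i) * (- y) ^ (j - i) / (K - i)!\<close>, up to a positive constant.
  This is a multiple of the associated Laguerre polynomial with parameter \<open>K - j\<close>, and
  Rodrigues' formula expresses it through the \<open>j\<close>-th derivative of \<open>y ^ K / K! * exp (- y)\<close>.
  Each derivative of order less than \<open>K\<close> vanishes at \<open>0\<close> and at infinity, so that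
  every differentiation produces one more change of sign (\<open>alternates_derivative\<close>). The limit
  therefore has \<open>j\<close> changes of sign on the positive half-line. They persist in \<open>J\<close> for large \<open>n\<close>
  and force \<open>j\<close> real roots, which are all the roots of \<open>J\<close>.
\<close>

section \<open>Forward differences and Jensen polynomials\<close>

definition forward_difference :: "(nat \<Rightarrow> 'a::ab_group_add) \<Rightarrow> nat \<Rightarrow> 'a" where
  "forward_difference \<omega> n = \<omega> (Suc n) - \<omega> n"

lemma funpow_forward_difference_Suc:
  "(forward_difference ^^ Suc j) \<omega> n =
    (forward_difference ^^ j) \<omega> (Suc n) - (forward_difference ^^ j) \<omega> n"
  by (subst funpow.simps(2), subst comp_apply, rule forward_difference_def)

text \<open>Pascal's rule; this is the step in the induction that proves the next lemma.\<close>
lemma jensen_sum_Suc: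
  fixes \<omega> :: "nat \<Rightarrow> real" and x :: real
  shows "(\<Sum>i\<le>Suc j. real (Suc j choose i) * \<omega> (n + i) * x ^ i) =
    (\<Sum>i\<le>j. real (j choose i) * \<omega> (n + i) * x ^ i) +
    x * (\<Sum>i\<le>j. real (j choose i) * \<omega> (Suc n + i) * x ^ i)"
proof -
  have "(\<Sum>i\<le>Suc j. real (Suc j choose i) * \<omega> (n + i) * x ^ i) =
      \<omega> n + (\<Sum>i\<le>j. real (Suc j choose Suc i) * \<omega> (Suc (n + i)) * x ^ Suc i)"
    by (subst sum.atMost_Suc_shift) simp
  also have "\<dots> = (\<omega> n + (\<Sum>i\<le>j. real (j choose Suc i) * \<omega> (Suc (n + i)) * x ^ Suc i)) +
      x * (\<Sum>i\<le>j. real (j choose i) * \<omega> (Suc n + i) * x ^ i)"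
    by (simp add: algebra_simps sum.distrib sum_distrib_left)
  also have "\<omega> n + (\<Sum>i\<le>j. real (j choose Suc i) * \<omega> (Suc (n + i)) * x ^ Suc i) =
      (\<Sum>i\<le>Suc j. real (j choose i) * \<omega> (n + i) * x ^ i)"
    by (subst sum.atMost_Suc_shift) simp
  also have "\<dots> = (\<Sum>i\<le>j. real (j choose i) * \<omega> (n + i) * x ^ i)" by simp
  finally show ?thesis .
qed

text \<open>
  With the shift \<open>E = 1 + \<Delta>\<close> the left-hand side is \<open>(1 + x * E) ^ j\<close> applied to \<open>\<omega>\<close> at \<open>n\<close>, and
  \<open>1 + x * E = (1 + x) + x * \<Delta>\<close>; the right-hand side is the binomial expansion of the latter.
\<close>
lemma jensen_sum_forward_difference:
  fixes \<omega> :: "nat \<Rightarrow> real" and x :: real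
  shows "(\<Sum>i\<le>j. real (j choose i) * \<omega> (n + i) * x ^ i) =
    (\<Sum>i\<le>j. real (j choose i) * (1 + x) ^ (j - i) * x ^ i * (forward_difference ^^ i) \<omega> n)"
proof (induction j arbitrary: \<omega> n)
  case 0
  show ?case by simp
next
  case (Suc j)
  let ?D = "\<lambda>i. (forward_difference ^^ i) \<omega> n"
  let ?D' = "\<lambda>i. (forward_difference ^^ i) (forward_difference \<omega>) n"
  have D': "?D' i = ?D (Suc i)" for i by (simp add: funpow_swap1)
  have "(\<Sum>i\<le>Suc j. real (Suc j choose i) * \<omega> (n + i) * x ^ i) =
      (1 + x) * (\<Sum>i\<le>j. real (j choose i) * \<omega> (n + i) * x ^ i) +
      x * (\<Sum>i\<le>j. real (j choose i) * forward_difference \<omega> (n + i) * x ^ i)"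
    unfolding jensen_sum_Suc
    by (simp add: forward_difference_def algebra_simps sum_subtractf sum.distrib sum_distrib_left)
  also have "\<dots> = (1 + x) * (\<Sum>i\<le>j. real (j choose i) * (1 + x) ^ (j - i) * x ^ i * ?D i) +
      x * (\<Sum>i\<le>j. real (j choose i) * (1 + x) ^ (j - i) * x ^ i * ?D (Suc i))"
    unfolding Suc.IH D' ..
  also have "(1 + x) * (\<Sum>i\<le>j. real (j choose i) * (1 + x) ^ (j - i) * x ^ i * ?D i) =
      (\<Sum>i\<le>Suc j. real (j choose i) * (1 + x) ^ (Suc j - i) * x ^ i * ?D i)"
    by (simp add: sum_distrib_left Suc_diff_le mult_ac)
  also have "\<dots> = (1 + x) ^ Suc j * \<omega> n +
      (\<Sum>i\<le>j. real (j choose Suc i) * (1 + x) ^ (j - i) * x ^ Suc i * ?D (Suc i))"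
    by (subst sum.atMost_Suc_shift) simp
  also have "\<dots> + x * (\<Sum>i\<le>j. real (j choose i) * (1 + x) ^ (j - i) * x ^ i * ?D (Suc i)) =
      (1 + x) ^ Suc j * \<omega> n +
      (\<Sum>i\<le>j. real (Suc j choose Suc i) * (1 + x) ^ (j - i) * x ^ Suc i * ?D (Suc i))"
    by (simp add: algebra_simps sum.distrib sum_distrib_left del: funpow.simps)
  also have "\<dots> = (\<Sum>i\<le>Suc j. real (Suc j choose i) * (1 + x) ^ (Suc j - i) * x ^ i * ?D i)"
    by (subst sum.atMost_Suc_shift) (simp del: funpow.simps add: funpow_0)
  finally show ?case .
qed

text \<open>The case \<open>x = -1\<close> of the preceding identity, in which only the term \<open>i = j\<close> survives.\<close>
lemma funpow_forward_difference_eq_sum: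
  fixes \<omega> :: "nat \<Rightarrow> real"
  shows "(forward_difference ^^ j) \<omega> n =
    (-1) ^ j * (\<Sum>i\<le>j. (-1) ^ i * real (j choose i) * \<omega> (n + i))"
proof -
  have "(\<Sum>i\<le>j. real (j choose i) * \<omega> (n + i) * (-1) ^ i) =
      (\<Sum>i\<le>j. if i = j then (-1) ^ j * (forward_difference ^^ j) \<omega> n else 0)"
    unfolding jensen_sum_forward_difference by (intro sum.cong) (auto simp: power_0_left)
  then have "(\<Sum>i\<le>j. (-1) ^ i * real (j choose i) * \<omega> (n + i)) =
      (-1) ^ j * (forward_difference ^^ j) \<omega> n"
    by (simp add: mult_ac)
  then show ?thesis by simp
qed

text \<open>
  The intermediate value theorem yields \<open>j\<close> distinct real roots. A further, non-real, root would
  exceed the degree.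
\<close>
lemma hyperbolic_if_alternating:
  fixes p :: "real poly"
  assumes deg: "degree p \<le> j"
    and mono: "\<And>t. t < j \<Longrightarrow> x t < x (Suc t)"
    and sign: "\<And>t. t \<le> j \<Longrightarrow> 0 < (-1) ^ t * poly p (x t)"
  shows "hyperbolic p"
proof -
  let ?P = "map_poly of_real p :: complex poly"
  have P_real: "poly ?P (of_real r) = of_real (poly p r)" for r
    by (induction p) (simp_all add: map_poly_pCons)
  have "p \<noteq> 0" using sign[of 0] by auto
  have "\<exists>r. x t < r \<and> r < x (Suc t) \<and> poly p r = 0" if "t < j" for t
  proof -
    have "t \<le> j" "Suc t \<le> j" using that by auto
    then have "0 < ((-1) ^ t * poly p (x t)) * ((-1) ^ Suc t * poly p (x (Suc t)))"
      by (intro mult_pos_pos sign)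
    also have "\<dots> = - (poly p (x t) * poly p (x (Suc t)))"
      by (simp flip: power_mult_distrib)
    finally show ?thesis using poly_IVT[OF mono[OF that]] by auto
  qed
  then obtain r where r: "\<And>t. t < j \<Longrightarrow> x t < r t \<and> r t < x (Suc t) \<and> poly p (r t) = 0"
    by metis
  have x_mono: "x s \<le> x t" if "s \<le> t" "t \<le> j" for s t
    using that
  proof (induction t rule: dec_induct)
    case (step t)
    then show ?case using mono[of t] by simp
  qed simp
  have r_less: "r s < r t" if "s < t" "t < j" for s t
    using r[of s] r[of t] x_mono[of "Suc s" t] that by force
  have inj: "inj_on r {..<j}"
  proof (rule inj_onI)
    fix s t assume "s \<in> {..<j}" "t \<in> {..<j}" "r s = r t"
    then show "s = t" using r_less[of s t] r_less[of t s] by (cases s t rule: linorder_cases) auto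
  qed
  show ?thesis
    unfolding hyperbolic_def
  proof (intro allI impI, rule ccontr)
    fix z :: complex assume z: "poly ?P z = 0" "z \<notin> \<real>"
    let ?R = "complex_of_real ` r ` {..<j}"
    have "?P \<noteq> 0" using \<open>p \<noteq> 0\<close> by (simp add: map_poly_eq_0_iff)
    have "card (insert z ?R) \<le> card {w. poly ?P w = 0}"
      using z r poly_roots_finite[OF \<open>?P \<noteq> 0\<close>] by (intro card_mono) (auto simp: P_real)
    also have "\<dots> \<le> degree ?P" by (rule card_poly_roots_bound) fact
    also have "\<dots> \<le> j" using deg by (simp add: degree_map_poly)
    finally have "card (insert z ?R) \<le> j" .
    moreover have "card ?R = j"
      using inj by (simp add: card_image inj_on_def)
    moreover have "z \<notin> ?R" using z(2) by auto
    ultimately show False by simp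
  qed
qed

section \<open>Sign changes of Laguerre polynomials\<close>

definition alternates :: "(real \<Rightarrow> real) \<Rightarrow> nat \<Rightarrow> bool" where
  "alternates f m \<longleftrightarrow> (\<exists>y. 0 < y 0 \<and> (\<forall>t<m. y t < y (Suc t)) \<and> (\<forall>t\<le>m. 0 < (-1) ^ t * f (y t)))"

text \<open>
  Rolle's argument in terms of signs. Two points are added to the \<open>m + 1\<close> given ones: one close to
  \<open>0\<close> and one far out, at which \<open>f\<close> is nearly \<open>0\<close>. Between any two neighbours among the
  \<open>m + 3\<close> points \<open>f\<close> moves from one sign towards the other, and the mean value theorem transfers the
  sign of each of the \<open>m + 2\<close> increments to the derivative.
\<close>
lemma alternates_derivative:
  assumes deriv: "\<And>y. 0 < y \<Longrightarrow> (f has_real_derivative f' y) (at y)"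
    and zero: "(f \<longlongrightarrow> 0) (at_right 0)" and inf: "(f \<longlongrightarrow> 0) at_top"
    and alt: "alternates f m"
  shows "alternates f' (Suc m)"
proof -
  obtain y where y0: "0 < y 0" and mono: "\<And>t. t < m \<Longrightarrow> y t < y (Suc t)"
    and sign: "\<And>t. t \<le> m \<Longrightarrow> 0 < (-1) ^ t * f (y t)"
    using alt unfolding alternates_def by auto
  have pos: "0 < y t" if "t \<le> m" for t
    using that
  proof (induction t)
    case (Suc t)
    then show ?case using mono[of t] by simp
  qed (rule y0)
  have "eventually (\<lambda>u. u \<in> {0<..<y 0}) (at_right 0)"
    using y0 by (rule eventually_at_right_real)
  moreover have "eventually (\<lambda>u. f u < f (y 0)) (at_right 0)"
    using sign[of 0] by (intro order_tendstoD(2)[OF zero]) simp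
  ultimately have "eventually (\<lambda>u. 0 < u \<and> u < y 0 \<and> f u < f (y 0)) (at_right 0)"
    by eventually_elim auto
  then obtain l where l: "0 < l" "l < y 0" "f l < f (y 0)"
    using eventually_happens'[OF trivial_limit_at_right_real] by blast
  have "((\<lambda>u. (-1) ^ m * f u) \<longlongrightarrow> 0) at_top"
    using tendsto_mult_right_zero[OF inf] .
  then have "eventually (\<lambda>u. (-1) ^ m * f u < (-1) ^ m * f (y m)) at_top"
    using sign[of m] by (intro order_tendstoD(2)) auto
  moreover have "eventually (\<lambda>u. y m < u) at_top" by (rule eventually_gt_at_top)
  ultimately have "eventually (\<lambda>u. y m < u \<and> (-1) ^ m * f u < (-1) ^ m * f (y m)) at_top"
    by eventually_elim auto
  then obtain r where r: "y m < r" "(-1) ^ m * f r < (-1) ^ m * f (y m)"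
    using eventually_happens'[OF trivial_limit_at_top_linorder] by blast
  define v where "v t = (case t of 0 \<Rightarrow> l | Suc s \<Rightarrow> if s \<le> m then y s else r)" for t
  have v_less: "v t < v (Suc t)" if "t \<le> Suc m" for t
    using that l(2) r(1) mono by (auto simp: v_def le_Suc_eq split: nat.split)
  have v_pos: "0 < v t" if "t \<le> Suc m" for t
    using that l(1) pos by (auto simp: v_def split: nat.split)
  have v_sign: "0 < (-1) ^ t * (f (v (Suc t)) - f (v t))" if "t \<le> Suc m" for t
  proof (cases t)
    case 0
    then show ?thesis using l(3) by (simp add: v_def)
  next
    case (Suc s)
    show ?thesis
    proof (cases "s = m")
      case True
      then show ?thesis using r(2) Suc by (simp add: v_def algebra_simps)
    next
      case False
      then show ?thesis
        using Suc that sign[of s] sign[of "Suc s"] by (simp add: v_def algebra_simps)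
    qed
  qed
  have "\<exists>z. v t < z \<and> z < v (Suc t) \<and> 0 < (-1) ^ t * f' z" if t: "t \<le> Suc m" for t
  proof -
    have "\<exists>z>v t. z < v (Suc t) \<and> f (v (Suc t)) - f (v t) = (v (Suc t) - v t) * f' z"
      using v_less[OF t] v_pos[OF t] by (intro MVT2 deriv) auto
    then obtain z where z: "v t < z" "z < v (Suc t)"
        "f (v (Suc t)) - f (v t) = (v (Suc t) - v t) * f' z" by auto
    have "0 < (v (Suc t) - v t) * ((-1) ^ t * f' z)"
      using v_sign[OF t] unfolding z(3) by (simp add: mult_ac)
    then show ?thesis using z v_less[OF t] by (auto simp: zero_less_mult_iff)
  qed
  then obtain z where z: "\<And>t. t \<le> Suc m \<Longrightarrow> v t < z t \<and> z t < v (Suc t) \<and> 0 < (-1) ^ t * f' (z t)"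
    by metis
  have "0 < z 0" using z[of 0] v_pos[of 0] by auto
  moreover have "z t < z (Suc t)" if "t < Suc m" for t
    using z[of t] z[of "Suc t"] that by auto
  ultimately show ?thesis using z unfolding alternates_def by blast
qed

text \<open>
  The density of the Gamma distribution with shape \<open>K - i + 1\<close>. The index \<open>i\<close> comes last so that
  differences can be taken in it: as long as \<open>i < K\<close>, the derivative with respect to \<open>y\<close> is the
  forward difference with respect to \<open>i\<close>. The \<open>j\<close>-th difference at \<open>0\<close> is thus the \<open>j\<close>-th
  derivative of \<open>y ^ K / K! * exp (- y)\<close>, which by Rodrigues' formula is \<open>y ^ (K - j) * exp (- y)\<close>
  times a multiple of a Laguerre polynomial.
\<close>
definition gamma_density :: "nat \<Rightarrow> real \<Rightarrow> nat \<Rightarrow> real" where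
  "gamma_density K y i = y ^ (K - i) / fact (K - i) * exp (- y)"

lemma gamma_density_difference_has_derivative:
  assumes "i + j < K"
  shows "((\<lambda>y. (forward_difference ^^ j) (gamma_density K y) i) has_real_derivative
    (forward_difference ^^ Suc j) (gamma_density K y) i) (at y)"
  using assms
proof (induction j arbitrary: i)
  case 0
  then obtain m where m: "K - i = Suc m" by (cases "K - i") auto
  then have m': "K - Suc i = m" by simp
  have "((\<lambda>y. y ^ Suc m / fact (Suc m)) has_real_derivative real (Suc m) * y ^ m / fact (Suc m)) (at y)"
    using DERIV_cdivide[OF DERIV_pow[of "Suc m"]] by (simp del: power_Suc fact_Suc)
  moreover have "((\<lambda>y. exp (- y)) has_real_derivative - exp (- y)) (at y)"
    by (auto intro!: derivative_eq_intros)
  ultimately have "((\<lambda>y. y ^ Suc m / fact (Suc m) * exp (- y)) has_real_derivative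
      real (Suc m) * y ^ m / fact (Suc m) * exp (- y) - y ^ Suc m / fact (Suc m) * exp (- y)) (at y)"
    by (rule DERIV_cong[OF DERIV_mult]) (simp add: mult_ac del: power_Suc fact_Suc)
  moreover have "real (Suc m) * y ^ m / fact (Suc m) = y ^ m / fact m"
    by (simp add: divide_simps)
  ultimately have "((\<lambda>y. y ^ Suc m / fact (Suc m) * exp (- y)) has_real_derivative
      y ^ m / fact m * exp (- y) - y ^ Suc m / fact (Suc m) * exp (- y)) (at y)"
    by (simp only:)
  then show ?case
    by (simp add: forward_difference_def gamma_density_def m m' del: power_Suc fact_Suc)
next
  case (Suc j)
  have "((\<lambda>y. (forward_difference ^^ j) (gamma_density K y) (Suc i) -
      (forward_difference ^^ j) (gamma_density K y) i) has_real_derivative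
      (forward_difference ^^ Suc j) (gamma_density K y) (Suc i) -
      (forward_difference ^^ Suc j) (gamma_density K y) i) (at y)"
    using Suc.prems by (intro DERIV_diff Suc.IH) auto
  then show ?case by (simp only: funpow_forward_difference_Suc)
qed

lemma gamma_density_difference_tendsto_0:
  shows "i + j < K \<Longrightarrow> ((\<lambda>y. (forward_difference ^^ j) (gamma_density K y) i) \<longlongrightarrow> 0) (at_right 0)"
    and "((\<lambda>y. (forward_difference ^^ j) (gamma_density K y) i) \<longlongrightarrow> 0) at_top"
proof (induction j arbitrary: i)
  case 0
  {
    case 1
    have "((\<lambda>y. y ^ (K - i) / fact (K - i) * exp (- y)) \<longlongrightarrow> 0 ^ (K - i) / fact (K - i) * exp (- 0 :: real)) (at_right 0)"
      by (intro tendsto_intros) auto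
    then show ?case using 1 by (simp add: gamma_density_def power_0_left)
  next
    case 2
    have "((\<lambda>y::real. 1 / fact (K - i) * (y ^ (K - i) / exp y)) \<longlongrightarrow> 0) at_top"
      by (intro tendsto_mult_right_zero tendsto_power_div_exp_0)
    then show ?case by (simp add: gamma_density_def exp_minus field_simps)
  }
next
  case (Suc j)
  {
    case 1
    then show ?case
      using tendsto_diff[OF Suc.IH(1)[of "Suc i"] Suc.IH(1)[of i]]
      by (simp add: funpow_forward_difference_Suc del: funpow.simps)
  next
    case 2
    show ?case
      using tendsto_diff[OF Suc.IH(2)[of "Suc i"] Suc.IH(2)[of i]]
      by (simp add: funpow_forward_difference_Suc del: funpow.simps)
  }
qed

lemma gamma_density_difference_alternates:
  assumes "j \<le> K"
  shows "alternates (\<lambda>y. (forward_difference ^^ j) (gamma_density K y) 0) j"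
  using assms
proof (induction j)
  case 0
  show ?case
    unfolding alternates_def by (intro exI[of _ "\<lambda>_. 1"]) (simp add: gamma_density_def)
next
  case (Suc j)
  show ?case
  proof (rule alternates_derivative)
    show "((\<lambda>y. (forward_difference ^^ j) (gamma_density K y) 0) has_real_derivative
        (forward_difference ^^ Suc j) (gamma_density K y) 0) (at y)" for y
      using Suc.prems by (intro gamma_density_difference_has_derivative) simp
    show "alternates (\<lambda>y. (forward_difference ^^ j) (gamma_density K y) 0) j"
      using Suc by simp
  qed (use Suc.prems in \<open>auto intro: gamma_density_difference_tendsto_0\<close>)
qed

lemma poly_jensen_poly:
  "poly (jensen_poly \<omega> j n) x = (\<Sum>i\<le>j. real (j choose i) * \<omega> (n + i) * x ^ i)"
  by (simp add: jensen_poly_def poly_sum poly_monom)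

lemma degree_jensen_poly: "degree (jensen_poly \<omega> j n) \<le> j"
  unfolding jensen_poly_def by (intro degree_sum_le) (auto intro: order_trans[OF degree_monom_le])

section \<open>Hyperbolicity from the growth of differences\<close>

text \<open>
  The hypothesis says that \<open>\<omega>\<close> has the same differences, up to order \<open>j\<close> and to leading order, as the
  polynomial \<open>c * n ^ K / K!\<close>. This suffices because the \<open>i\<close>-th term of the Jensen sum in its
  difference form contributes at the same scale for every \<open>i\<close>, and having \<open>j\<close> strict sign changes is
  stable under small perturbations.
\<close>
theorem turan_inequality_if_differences_asymptotic:
  fixes \<omega> :: "nat \<Rightarrow> real"
  assumes "0 < c" "j \<le> K"
    and lim: "\<And>i. i \<le> j \<Longrightarrow>
      (\<lambda>n. (forward_difference ^^ i) \<omega> n / real n ^ (K - i)) \<longlonglongrightarrow> c / fact (K - i)"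
  shows "eventually (turan_inequality \<omega> j) sequentially"
proof -
  define h where "h y = (forward_difference ^^ j) (gamma_density K y) 0" for y
  define L where "L y = (\<Sum>i\<le>j. real (j choose i) * (- y) ^ (j - i) * (c / fact (K - i)))" for y :: real
  define H where "H n y = (\<Sum>i\<le>j. real (j choose i) * (- y) ^ (j - i) *
    ((forward_difference ^^ i) \<omega> n / real n ^ (K - i)))" for n y
  \<comment> \<open>\<open>L\<close> is the Laguerre-type limit of \<open>H n\<close>; \<open>h\<close> has the same signs on the positive half-line.\<close>
  obtain y where y0: "0 < y 0" and mono: "\<And>t. t < j \<Longrightarrow> y t < y (Suc t)"
    and sign: "\<And>t. t \<le> j \<Longrightarrow> 0 < (-1) ^ t * h (y t)"
    using gamma_density_difference_alternates[OF \<open>j \<le> K\<close>] unfolding alternates_def h_def by auto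
  have pos: "0 < y t" if "t \<le> j" for t
    using that
  proof (induction t)
    case (Suc t)
    then show ?case using mono[of t] by simp
  qed (rule y0)
  have h_L: "c * h u = exp (- u) * u ^ (K - j) * L u" for u
  proof -
    have "c * ((-1) ^ j * ((-1) ^ i * real (j choose i) * gamma_density K u i)) =
        exp (- u) * u ^ (K - j) * (real (j choose i) * (- u) ^ (j - i) * (c / fact (K - i)))"
      if "i \<le> j" for i
    proof -
      have "u ^ (K - i) = u ^ (K - j) * u ^ (j - i)"
        using that \<open>j \<le> K\<close> by (simp flip: power_add)
      moreover have "(- u) ^ (j - i) = (-1) ^ j * (-1) ^ i * u ^ (j - i)"
        using that by (subst power_minus) (simp add: minus_one_power_iff)
      ultimately show ?thesis by (simp add: gamma_density_def)
    qed
    then show ?thesis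
      unfolding h_def L_def funpow_forward_difference_eq_sum by (simp add: sum_distrib_left)
  qed
  have L_sign: "0 < (-1) ^ t * L (y t)" if "t \<le> j" for t
  proof -
    have "0 < c * ((-1) ^ t * h (y t))" using sign[OF that] \<open>0 < c\<close> by simp
    also have "\<dots> = (exp (- y t) * y t ^ (K - j)) * ((-1) ^ t * L (y t))"
      using h_L[of "y t"] by (simp add: algebra_simps)
    finally show ?thesis by (rule zero_less_mult_pos) (use pos[OF that] in simp)
  qed
  have "(\<lambda>n. (-1) ^ t * H n u) \<longlonglongrightarrow> (-1) ^ t * L u" for t u
    unfolding H_def L_def by (intro tendsto_intros lim) auto
  then have "eventually (\<lambda>n. 0 < (-1) ^ t * H n (y t)) sequentially" if "t \<le> j" for t
    using order_tendstoD(1) L_sign[OF that] by blast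
  then have "eventually (\<lambda>n. \<forall>t\<in>{..j}. 0 < (-1) ^ t * H n (y t)) sequentially"
    by (subst eventually_ball_finite_distrib) auto
  moreover have "eventually (\<lambda>n. 0 < n) sequentially" by (rule eventually_gt_at_top)
  ultimately show ?thesis
  proof eventually_elim
    case (elim n)
    \<comment> \<open>The substitution turns \<open>1 + x\<close> into \<open>- x * y / n\<close>, which balances the decay of the differences.\<close>
    define J where "J = jensen_poly \<omega> j n"
    define x where "x t = - real n / (y t + real n)" for t
    have J_H: "poly J (x t) = x t ^ j * real n ^ (K - j) * H n (y t)" if "t \<le> j" for t
    proof -
      have "y t + real n > 0" using pos[OF that] elim by simp
      then have x: "1 + x t = x t * (- y t / real n)"
        using elim by (simp add: x_def field_simps)
      have "real (j choose i) * (1 + x t) ^ (j - i) * x t ^ i * (forward_difference ^^ i) \<omega> n =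
          x t ^ j * real n ^ (K - j) * (real (j choose i) * (- y t) ^ (j - i) *
          ((forward_difference ^^ i) \<omega> n / real n ^ (K - i)))" if "i \<le> j" for i
      proof -
        have "real n ^ (K - i) = real n ^ (K - j) * real n ^ (j - i)"
          "x t ^ j = x t ^ (j - i) * x t ^ i"
          using that \<open>j \<le> K\<close> by (simp_all flip: power_add)
        then show ?thesis
          unfolding x power_mult_distrib power_divide using elim by simp
      qed
      then show ?thesis
        by (simp add: J_def poly_jensen_poly jensen_sum_forward_difference H_def sum_distrib_left)
    qed
    \<comment> \<open>All \<open>x t\<close> are negative, so \<open>x t ^ j\<close> has the constant sign \<open>(-1) ^ j\<close>, which is divided out.\<close>
    have "hyperbolic (smult ((-1) ^ j) J)"
    proof (rule hyperbolic_if_alternating)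
      show "degree (smult ((-1) ^ j) J) \<le> j"
        using degree_jensen_poly[of \<omega> j n] by (simp add: J_def)
      show "x t < x (Suc t)" if "t < j" for t
        using mono[OF that] pos[of t] that elim by (simp add: x_def divide_simps)
      show "0 < (-1) ^ t * poly (smult ((-1) ^ j) J) (x t)" if "t \<le> j" for t
      proof -
        have "0 < (real n / (y t + real n)) ^ j * real n ^ (K - j) * ((-1) ^ t * H n (y t))"
          using elim that pos[OF that] by simp
        also have "(real n / (y t + real n)) ^ j = (-1) ^ j * x t ^ j"
          by (simp add: x_def flip: power_mult_distrib)
        finally show ?thesis by (simp add: J_H[OF that] mult_ac)
      qed
    qed
    then have "hyperbolic J"
      by (simp add: hyperbolic_def map_poly_smult)
    then show ?case by (simp add: turan_inequality_def J_def)
  qed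
qed

section \<open>Reducing the denominator of the generating function\<close>

text \<open>
  The sum \<open>\<Sum>i<a. x ^ i\<close> is squarefree because \<open>1 - x ^ a\<close> is: a multiple prime factor
  of the latter divides its derivative too, hence divides \<open>x ^ a\<close>, and so \<open>1\<close>.
\<close>
lemma prime_sq_not_dvd_geometric_sum:
  fixes p :: "real poly"
  assumes p: "prime p" and a: "0 < a"
  shows "\<not> p\<^sup>2 dvd (\<Sum>i<a. [:0, 1:] ^ i)"
proof
  let ?X = "[:0, 1:] :: real poly"
  assume "p\<^sup>2 dvd (\<Sum>i<a. ?X ^ i)"
  then have "p\<^sup>2 dvd 1 - ?X ^ a" unfolding one_diff_power_eq by (rule dvd_mult)
  then obtain q where q: "1 - ?X ^ a = p\<^sup>2 * q" by (elim dvdE)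
  have "p dvd pderiv (p\<^sup>2 * q)"
    by (simp add: pderiv_mult pderiv_power_Suc power2_eq_square)
  also have "pderiv (p\<^sup>2 * q) = - (smult (real a) (?X ^ (a - 1)))"
    using a unfolding q[symmetric] by (cases a) (simp_all add: pderiv_diff pderiv_power_Suc pderiv_pCons del: power_Suc)
  finally have "p dvd ?X ^ (a - 1)"
    using a by (simp add: dvd_smult_iff)
  then have "p dvd ?X * ?X ^ (a - 1)" by (rule dvd_mult)
  then have "p dvd ?X ^ a" unfolding power_minus_mult[OF a, symmetric] by (simp only: mult.commute)
  moreover have "p dvd 1 - ?X ^ a" unfolding q by (simp add: power2_eq_square)
  ultimately have "p dvd (1 - ?X ^ a) + ?X ^ a" by (rule dvd_add[rotated])
  then show False using p by (simp add: prime_def prime_elem_def)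
qed

text \<open>
  If \<open>x ^ a\<close> is \<open>1\<close> modulo \<open>p\<close> for all \<open>a\<close> in \<open>M\<close>, then the order of \<open>x\<close> modulo \<open>p\<close> divides every
  element of \<open>M\<close>, hence their gcd. Bezout's identity gives this without reference to the order.
\<close>
lemma dvd_one_diff_power_Gcd:
  fixes p x :: "'a :: comm_ring_1"
  assumes "finite M" "\<And>a. a \<in> M \<Longrightarrow> p dvd 1 - x ^ a"
  shows "p dvd 1 - x ^ Gcd M"
  using assms
proof (induction M rule: finite_induct)
  case empty
  show ?case by simp
next
  case (insert a M)
  have mult: "p dvd 1 - x ^ (b * c)" if "p dvd 1 - x ^ b" for b c
  proof -
    have "1 - x ^ b dvd 1 - (x ^ b) ^ c" unfolding one_diff_power_eq[of "x ^ b"] by simp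
    with that show ?thesis by (simp add: power_mult dvd_trans)
  qed
  show ?case
  proof (cases "a = 0")
    case True
    then show ?thesis using insert by simp
  next
    case False
    then obtain u v where uv: "a * u = Gcd M * v + gcd a (Gcd M)"
      using bezout_nat by blast
    have "p dvd 1 - x ^ (a * u)" "p dvd 1 - x ^ (Gcd M * v)"
      using mult[OF insert.prems[of a]] mult[OF insert.IH] insert.prems by simp_all
    then have "p dvd (1 - x ^ (a * u)) - x ^ gcd a (Gcd M) * (1 - x ^ (Gcd M * v))"
      by (rule dvd_diff[OF _ dvd_mult])
    also have "\<dots> = 1 - x ^ gcd a (Gcd M)"
      unfolding uv by (simp add: algebra_simps power_add)
    finally show ?thesis by simp
  qed
qed

text \<open>Modulo \<open>1 - x\<close> the sum is the nonzero constant \<open>a\<close>.\<close>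
lemma prime_not_dvd_geometric_sum_if_dvd_one_diff:
  fixes p :: "real poly"
  assumes "prime p" "p dvd 1 - [:0, 1:]" "0 < a"
  shows "\<not> p dvd (\<Sum>i<a. [:0, 1:] ^ i)"
proof
  let ?X = "[:0, 1:] :: real poly"
  assume "p dvd (\<Sum>i<a. ?X ^ i)"
  moreover have "p dvd (\<Sum>i<a. 1 - ?X ^ i)"
    using assms(2) by (intro dvd_sum) (simp only: one_diff_power_eq dvd_mult2)
  ultimately have "p dvd (\<Sum>i<a. 1 - ?X ^ i) + (\<Sum>i<a. ?X ^ i)" by (rule dvd_add[rotated])
  also have "\<dots> = of_nat a" by (simp add: sum_subtractf)
  finally have "p dvd of_nat a" .
  then have "p dvd [:real a:]" by (simp only: of_nat_poly)
  moreover have "[:real a:] dvd 1" using \<open>0 < a\<close> by (simp add: is_unit_const_poly_iff dvd_field_iff)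
  ultimately have "p dvd 1" by (rule dvd_trans)
  then show False using \<open>prime p\<close> by (simp add: prime_def prime_elem_def)
qed

text \<open>
  Multiplicities of a prime \<open>p\<close> are compared. On the left, \<open>p\<close> occurs once for each
  \<open>a\<in>#A\<close> with \<open>p\<close> dividing \<open>\<Sum>i<a. x ^ i\<close>. More than \<open>s\<close> such \<open>a\<close> would have gcd \<open>1\<close>, so that
  \<open>p\<close> would divide \<open>1 - x\<close>, which is impossible. If there is at least one such \<open>a\<close>, then \<open>p\<close>
  divides \<open>\<Sum>i<N. x ^ i\<close>, as \<open>a\<close> divides \<open>N\<close>, and it occurs at least \<open>s\<close> times on the right.
\<close>
lemma prod_geometric_sums_dvd_power:
  fixes A :: "nat multiset"
  assumes pos: "\<forall>a\<in>#A. 0 < a" and "0 < N" and N: "\<forall>a\<in>#A. a dvd N"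
    and gcd: "\<And>B. B \<subseteq># A \<Longrightarrow> s < size B \<Longrightarrow> Gcd (set_mset B) = 1"
  shows "(\<Prod>a\<in>#A. \<Sum>i<a. [:0, 1:] ^ i) dvd (\<Sum>i<N. [:0, 1 :: real:] ^ i) ^ s"
proof (rule multiplicity_le_imp_dvd)
  let ?X = "[:0, 1:] :: real poly"
  let ?g = "\<lambda>a. \<Sum>i<a. ?X ^ i"
  have g_nz: "?g a \<noteq> 0" if "0 < a" for a
  proof
    assume "?g a = 0"
    then have "poly (?g a) 1 = 0" by simp
    then show False using that by (simp add: poly_sum)
  qed
  then show "(\<Prod>a\<in>#A. ?g a) \<noteq> 0" using pos by auto
  fix p :: "real poly" assume p: "prime p"
  define B where "B = filter_mset (\<lambda>a. p dvd ?g a) A"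
  have "multiplicity p (?g a) \<le> (if p dvd ?g a then 1 else 0)" if "0 < a" for a
    using multiplicity_lessI[OF g_nz[OF that] _ prime_sq_not_dvd_geometric_sum[OF p that]] p
    by (auto simp: not_dvd_imp_multiplicity_0)
  then have "(\<Sum>a\<in>#A. multiplicity p (?g a)) \<le> (\<Sum>a\<in>#A. if p dvd ?g a then 1 else 0)"
    using pos by (intro sum_mset_mono) auto
  also have "\<dots> = size B"
    unfolding B_def by (induction A) auto
  also have "(\<Sum>a\<in>#A. multiplicity p (?g a)) = multiplicity p (\<Prod>a\<in>#A. ?g a)"
    using p pos g_nz by (subst prime_elem_multiplicity_prod_mset_distrib) (auto simp: image_mset.compositionality o_def)
  finally have le_size: "multiplicity p (\<Prod>a\<in>#A. ?g a) \<le> size B" .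
  show "multiplicity p (\<Prod>a\<in>#A. ?g a) \<le> multiplicity p (?g N ^ s)"
  proof (cases "B = {#}")
    case True
    then show ?thesis using le_size by simp
  next
    case False
    then obtain b where b: "b \<in># A" "p dvd ?g b" by (auto simp: B_def filter_mset_eq_conv)
    have "B \<subseteq># A" by (simp add: B_def)
    have X: "p dvd 1 - ?X ^ a" if "a \<in># B" for a
      using that unfolding one_diff_power_eq by (simp add: B_def)
    have not_X: "\<not> p dvd 1 - ?X"
      using prime_not_dvd_geometric_sum_if_dvd_one_diff[OF p] b pos by blast
    have "size B \<le> s"
    proof (rule ccontr)
      assume "\<not> size B \<le> s"
      then have "Gcd (set_mset B) = 1" using gcd \<open>B \<subseteq># A\<close> by simp
      moreover have "p dvd 1 - ?X ^ Gcd (set_mset B)"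
        using X by (intro dvd_one_diff_power_Gcd) auto
      ultimately show False using not_X by simp
    qed
    moreover have "p dvd ?g N"
    proof -
      obtain c where c: "N = b * c" using N b(1) by (auto elim: dvdE)
      have "p dvd 1 - ?X ^ b" using b(2) unfolding one_diff_power_eq by simp
      also have "1 - ?X ^ b dvd 1 - (?X ^ b) ^ c" unfolding one_diff_power_eq[of "?X ^ b"] by simp
      also have "\<dots> = (1 - ?X) * ?g N" by (simp only: c power_mult one_diff_power_eq[symmetric])
      finally show ?thesis using p not_X prime_dvd_mult_iff by blast
    qed
    then have "1 \<le> multiplicity p (?g N)"
      using g_nz[OF \<open>0 < N\<close>] p by (intro multiplicity_geI) auto
    then have "s \<le> multiplicity p (?g N ^ s)"
      using p g_nz[OF \<open>0 < N\<close>] by (simp add: prime_elem_multiplicity_power_distrib)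
    ultimately show ?thesis using le_size by linarith
  qed
qed

section \<open>Growth of the coefficients\<close>

text \<open>
  Passing from \<open>s\<close> to \<open>s + 1\<close> multiplies the binomial coefficient by \<open>(e + s + 1) / (s + 1)\<close>, where
  \<open>e\<close> is the quotient by \<open>N\<close>; divided by \<open>n\<close>, this factor tends to \<open>1 / (N * (s + 1))\<close>.
\<close>
lemma tendsto_binomial_div_power:
  assumes "0 < N"
  shows "(\<lambda>n. real (((n + r - q) div N + s) choose s) / real n ^ s) \<longlonglongrightarrow> 1 / (real N ^ s * fact s)"
proof (induction s)
  case 0
  show ?case by simp
next
  case (Suc s)
  have quotient: "(\<lambda>n. real ((n + r - q) div N) / real n) \<longlonglongrightarrow> 1 / real N"
  proof (rule tendsto_sandwich)
    have inv: "(\<lambda>n. 1 / real n) \<longlonglongrightarrow> 0" by (rule lim_1_over_n)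
    have "(\<lambda>n. 1 / real N - (real q / real N + 1) * (1 / real n)) \<longlonglongrightarrow>
        1 / real N - (real q / real N + 1) * 0"
      by (intro tendsto_intros inv)
    then show "(\<lambda>n. 1 / real N - (real q / real N + 1) * (1 / real n)) \<longlonglongrightarrow> 1 / real N" by simp
    have "(\<lambda>n. 1 / real N + real r / real N * (1 / real n)) \<longlonglongrightarrow> 1 / real N + real r / real N * 0"
      by (intro tendsto_intros inv)
    then show "(\<lambda>n. 1 / real N + real r / real N * (1 / real n)) \<longlonglongrightarrow> 1 / real N" by simp
    show "eventually (\<lambda>n. 1 / real N - (real q / real N + 1) * (1 / real n) \<le>
        real ((n + r - q) div N) / real n) sequentially"
      using eventually_gt_at_top[of 0]
    proof eventually_elim
      case (elim n)
      define e where "e = (n + r - q) div N"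
      have "n + r - q < N * (e + 1)"
        using \<open>0 < N\<close> unfolding e_def by (simp add: dividend_less_times_div)
      then have "n \<le> N * e + N + q" by simp
      then have "real n \<le> real N * real e + real N + real q"
        unfolding of_nat_mult[symmetric] of_nat_add[symmetric] of_nat_le_iff .
      then have "(real n - real q - real N) / real N \<le> real e"
        using \<open>0 < N\<close> by (simp add: field_simps)
      then have "(real n - real q - real N) / real N / real n \<le> real e / real n"
        by (rule divide_right_mono) simp
      moreover have "1 / real N - (real q / real N + 1) * (1 / real n) =
          (real n - real q - real N) / real N / real n"
        using elim \<open>0 < N\<close> by (simp add: field_simps)
      ultimately show ?case unfolding e_def by simp
    qed
    show "eventually (\<lambda>n. real ((n + r - q) div N) / real n \<le>
        1 / real N + real r / real N * (1 / real n)) sequentially"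
      using eventually_gt_at_top[of 0]
    proof eventually_elim
      case (elim n)
      define e where "e = (n + r - q) div N"
      have "e * N \<le> n + r - q" by (simp add: e_def)
      then have "e * N \<le> n + r" by simp
      then have "real e * real N \<le> real n + real r"
        unfolding of_nat_mult[symmetric] of_nat_add[symmetric] of_nat_le_iff .
      then show ?case
        using elim \<open>0 < N\<close> unfolding e_def[symmetric] by (simp add: field_simps)
    qed
  qed
  have "(\<lambda>n. real (((n + r - q) div N + s) choose s) / real n ^ s *
      ((real ((n + r - q) div N) / real n + real (Suc s) * (1 / real n)) / real (Suc s))) \<longlonglongrightarrow>
      1 / (real N ^ s * fact s) * ((1 / real N + real (Suc s) * 0) / real (Suc s))"
    by (intro tendsto_intros Suc.IH quotient lim_1_over_n) simp
  moreover have "real ((e + Suc s) choose Suc s) / real n ^ Suc s =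
      real ((e + s) choose s) / real n ^ s * ((real e / real n + real (Suc s) * (1 / real n)) / real (Suc s))"
    for e n
  proof -
    have "Suc s * (Suc (e + s) choose Suc s) = Suc (e + s) * ((e + s) choose s)"
      by (rule Suc_times_binomial)
    then have "real (Suc s) * real ((e + Suc s) choose Suc s) =
        (real e + real (Suc s)) * real ((e + s) choose s)"
      unfolding of_nat_mult[symmetric] of_nat_add[symmetric] of_nat_eq_iff by simp
    then have "real ((e + Suc s) choose Suc s) =
        (real e + real (Suc s)) * real ((e + s) choose s) / real (Suc s)"
      by (simp add: eq_divide_eq mult.commute del: of_nat_Suc)
    moreover have "real e / real n + real (Suc s) * (1 / real n) = (real e + real (Suc s)) / real n"
      by (simp add: add_divide_distrib del: of_nat_Suc)
    ultimately show ?thesis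
      by (simp only: power_Suc times_divide_eq_left times_divide_eq_right divide_divide_eq_left mult_ac)
  qed
  ultimately show ?case by (simp add: mult_ac)
qed

text \<open>
  The expansion of \<open>1 / ((1 - x) * (1 - x ^ N) ^ s)\<close>. The coefficients of \<open>1 / (1 - x ^ N) ^ s\<close> sit
  at the multiples of \<open>N\<close>, and the factor \<open>1 / (1 - x)\<close> replaces them by their partial sums, which
  are constant on blocks of length \<open>N\<close> and grow regularly.
\<close>
lemma fps_binomial_div_mult:
  assumes "0 < N"
  shows "Abs_fps (\<lambda>n. real ((n div N + s) choose s)) * ((1 - fps_X) * (1 - fps_X ^ N) ^ s) = 1"
proof (induction s)
  case 0
  show ?case by (rule fps_ext) (auto simp: algebra_simps)
next
  case (Suc s)
  let ?G = "\<lambda>s. Abs_fps (\<lambda>n. real ((n div N + s) choose s))"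
  have "?G (Suc s) = fps_X ^ N * ?G (Suc s) + ?G s"
  proof (rule fps_ext)
    fix n
    show "?G (Suc s) $ n = (fps_X ^ N * ?G (Suc s) + ?G s) $ n"
      using assms by (cases "n < N") (simp_all add: fps_X_power_mult_nth le_div_geq not_less)
  qed
  then have "?G (Suc s) * (1 - fps_X ^ N) = ?G s" by (simp add: algebra_simps)
  moreover have "?G (Suc s) * ((1 - fps_X) * (1 - fps_X ^ N) ^ Suc s) =
      (?G (Suc s) * (1 - fps_X ^ N)) * ((1 - fps_X) * (1 - fps_X ^ N) ^ s)"
    by (simp only: power_Suc mult_ac)
  ultimately show ?case using Suc by (simp only:)
qed

text \<open>
  Multiplication by \<open>T\<close> combines finitely many shifts of the preceding coefficients, and a shift does
  not change the leading growth; the total weight of the shifts is \<open>T(1)\<close>.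
\<close>
lemma tendsto_fps_nth_div_power:
  fixes F :: "real fps"
  assumes "0 < N" and F: "F * ((1 - fps_X) * (1 - fps_X ^ N) ^ s) = fps_of_poly T"
  shows "(\<lambda>n. F $ (n + r) / real n ^ s) \<longlonglongrightarrow> poly T 1 / (real N ^ s * fact s)"
proof -
  let ?b = "\<lambda>n. real ((n div N + s) choose s)"
  have "F = fps_of_poly T * Abs_fps ?b"
    unfolding F[symmetric] using fps_binomial_div_mult[OF \<open>0 < N\<close>, of s] by (simp add: mult_ac)
  then have "F $ n = (\<Sum>q\<le>n. coeff T q * ?b (n - q))" for n
    by (simp add: fps_mult_nth atLeast0AtMost)
  also have "(\<Sum>q\<le>n. coeff T q * ?b (n - q)) = (\<Sum>q\<le>degree T. coeff T q * ?b (n - q))"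
    if "degree T \<le> n" for n
    using that by (intro sum.mono_neutral_right) (auto intro: coeff_eq_0)
  finally have F_nth: "F $ n = (\<Sum>q\<le>degree T. coeff T q * ?b (n - q))" if "degree T \<le> n" for n
    using that .
  have "(\<lambda>n. \<Sum>q\<le>degree T. coeff T q * (?b (n + r - q) / real n ^ s)) \<longlonglongrightarrow>
      (\<Sum>q\<le>degree T. coeff T q * (1 / (real N ^ s * fact s)))"
    by (intro tendsto_intros tendsto_binomial_div_power assms)
  moreover have "eventually (\<lambda>n. (\<Sum>q\<le>degree T. coeff T q * (?b (n + r - q) / real n ^ s)) =
      F $ (n + r) / real n ^ s) sequentially"
    using eventually_ge_at_top[of "degree T"]
    by eventually_elim (simp add: F_nth sum_divide_distrib)
  ultimately have "(\<lambda>n. F $ (n + r) / real n ^ s) \<longlonglongrightarrow>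
      (\<Sum>q\<le>degree T. coeff T q * (1 / (real N ^ s * fact s)))"
    by (rule Lim_transform_eventually)
  moreover have "poly T 1 = (\<Sum>q\<le>degree T. coeff T q)" by (simp add: poly_altdef)
  ultimately show ?thesis by (simp add: sum_distrib_right sum_divide_distrib)
qed

section \<open>Differences of the partition function\<close>

text \<open>
  Multiplying by \<open>1 - x\<close> takes backward differences; the shift of the index by \<open>i\<close> turns these
  into forward differences and keeps clear of the initial coefficients.
\<close>
lemma fps_nth_one_diff_X_power_mult:
  fixes F :: "real fps"
  shows "((1 - fps_X) ^ i * F) $ (n + i) = (forward_difference ^^ i) (fps_nth F) n"
proof (induction i arbitrary: n)
  case 0
  show ?case by simp
next
  case (Suc i)
  have "(1 - fps_X) ^ Suc i * F = (1 - fps_X) ^ i * F - fps_X * ((1 - fps_X) ^ i * F)"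
    by (simp add: algebra_simps)
  then show ?case
    using Suc.IH[of n] Suc.IH[of "Suc n"]
    by (simp add: funpow_forward_difference_Suc del: funpow.simps power_Suc)
qed

lemma prod_mset_one_diff_X_power:
  "(\<Prod>a\<in>#A. 1 - fps_X ^ a) =
    (1 - fps_X) ^ size A * fps_of_poly (\<Prod>a\<in>#A. \<Sum>i<a. [:0, 1 :: real:] ^ i)"
  by (induction A)
     (simp_all add: fps_of_poly_mult fps_of_poly_sum fps_of_poly_power one_diff_power_eq mult_ac)

lemma prod_mset_inverse_one_diff_X_power:
  fixes A :: "nat multiset"
  assumes "\<forall>a\<in>#A. 0 < a"
  shows "(\<Prod>a\<in>#A. inverse (1 - fps_X ^ a)) * (\<Prod>a\<in>#A. 1 - fps_X ^ a) = (1 :: real fps)"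
  using assms
proof (induction A)
  case (add a A)
  have "inverse (1 - fps_X ^ a) * (1 - fps_X ^ a) = (1 :: real fps)"
    using add.prems by (intro inverse_mult_eq_1) (simp add: fps_X_power_nth)
  moreover have "(\<Prod>b\<in>#add_mset a A. inverse (1 - fps_X ^ b)) * (\<Prod>b\<in>#add_mset a A. 1 - fps_X ^ b) =
      (inverse (1 - fps_X ^ a) * (1 - fps_X ^ a)) *
      ((\<Prod>b\<in>#A. inverse (1 - fps_X ^ b)) * (\<Prod>b\<in>#A. 1 - fps_X ^ b) :: real fps)"
    by (simp add: mult_ac)
  ultimately show ?case using add by simp
qed simp

text \<open>
  In the generating function of the \<open>i\<close>-th difference, \<open>i\<close> of the \<open>s + i + 1\<close> factors \<open>1 - x\<close> of the
  denominator cancel. The remaining cofactor of \<open>(1 - x) ^ (s + 1)\<close>, a product of geometric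
  sums, divides \<open>(\<Sum>i<N. x ^ i) ^ s\<close> for \<open>N\<close> the product of all parts. Extending the fraction by the
  quotient \<open>T\<close> gives the shape required in \<open>tendsto_fps_nth_div_power\<close>, and evaluation at \<open>1\<close>
  gives \<open>T(1) = N ^ s / N\<close>.
\<close>
lemma partition_fun_difference_asymptotic:
  assumes pos: "\<forall>a\<in>#A. 0 < a" and size: "size A = Suc (s + i)"
    and gcd: "\<And>B. B \<subseteq># A \<Longrightarrow> s < size B \<Longrightarrow> Gcd (set_mset B) = 1"
  shows "(\<lambda>n. (forward_difference ^^ i) (\<lambda>m. real (partition_fun A m)) n / real n ^ s) \<longlonglongrightarrow>
    1 / (real (prod_mset A) * fact s)"
proof -
  let ?g = "\<lambda>a. \<Sum>i<a. [:0, 1 :: real:] ^ i"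
  let ?P = "Abs_fps (\<lambda>m. real (partition_fun A m))"
  define N where "N = prod_mset A"
  have "0 < N" using pos unfolding N_def by (auto intro!: Nat.gr0I simp: prod_mset_zero_iff)
  have "(\<Prod>a\<in>#A. ?g a) dvd ?g N ^ s"
    using pos \<open>0 < N\<close> gcd by (intro prod_geometric_sums_dvd_power) (auto simp: N_def dvd_prod_mset)
  then obtain T where T: "?g N ^ s = (\<Prod>a\<in>#A. ?g a) * T" by (elim dvdE)
  have P: "?P * ((1 - fps_X) ^ size A * fps_of_poly (\<Prod>a\<in>#A. ?g a)) = 1"
    unfolding partition_fun_gf[OF pos] prod_mset_one_diff_X_power[symmetric]
    by (rule prod_mset_inverse_one_diff_X_power[OF pos])
  have N: "1 - fps_X ^ N = (1 - fps_X) * fps_of_poly (?g N)"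
    by (simp add: one_diff_power_eq fps_of_poly_sum fps_of_poly_power)
  have "((1 - fps_X) ^ i * ?P) * ((1 - fps_X) * (1 - fps_X ^ N) ^ s) =
      (?P * ((1 - fps_X) ^ size A * fps_of_poly (\<Prod>a\<in>#A. ?g a))) * fps_of_poly T"
    unfolding N power_mult_distrib fps_of_poly_power[symmetric] T size
    by (simp add: fps_of_poly_mult power_add mult_ac)
  then have "((1 - fps_X) ^ i * ?P) * ((1 - fps_X) * (1 - fps_X ^ N) ^ s) = fps_of_poly T"
    unfolding P by simp
  from tendsto_fps_nth_div_power[OF \<open>0 < N\<close> this, of i]
  have "(\<lambda>n. (forward_difference ^^ i) (\<lambda>m. real (partition_fun A m)) n / real n ^ s) \<longlonglongrightarrow>
      poly T 1 / (real N ^ s * fact s)"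
    unfolding fps_nth_one_diff_X_power_mult by (simp add: fps_nth_Abs_fps[abs_def])
  moreover have "real N ^ s = real N * poly T 1"
  proof -
    have g1: "poly (?g a) 1 = real a" for a by (simp add: poly_sum)
    have "poly (\<Prod>a\<in>#A. ?g a) 1 = real N"
      unfolding N_def by (induction A) (simp_all add: g1)
    then show ?thesis using arg_cong[OF T, of "\<lambda>p. poly p 1"] by (simp add: g1)
  qed
  then have "poly T 1 / (real N ^ s * fact s) = 1 / (real (prod_mset A) * fact s)"
    using \<open>0 < N\<close> by (auto simp: N_def[symmetric] divide_simps)
  ultimately show ?thesis by simp
qed

text \<open>
  The condition on multisubsets with \<open>k - d\<close> elements passes to all larger ones, since enlarging a
  multiset can only make its gcd smaller. This is what the asymptotics of the \<open>i\<close>-th difference require,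
  as \<open>s = k - 1 - i\<close> and \<open>s < size B\<close> give \<open>k - d \<le> size B\<close> for \<open>i \<le> d\<close>.
\<close>
theorem theorem3p2:
  fixes A :: "nat multiset" and k d :: nat
  assumes "\<forall>a\<in>#A. 0 < a"
    and "size A = k"
    and "1 \<le> d" and "d < k"
    and "\<forall>B. B \<subseteq># A \<and> size B = k - d \<longrightarrow> Gcd (set_mset B) = 1"
  shows "\<forall>j. 1 \<le> j \<and> j \<le> d \<longrightarrow>
    (\<forall>\<^sub>F n in sequentially. turan_inequality (\<lambda>m. real (partition_fun A m)) j n)"
proof (intro allI impI)
  fix j assume j: "1 \<le> j \<and> j \<le> d"
  have gcd: "Gcd (set_mset B) = 1" if B: "B \<subseteq># A" "k - d \<le> size B" for B
  proof -
    obtain xs where xs: "mset xs = B" using ex_mset by blast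
    define C where "C = mset (take (k - d) xs)"
    have "C + mset (drop (k - d) xs) = B"
      unfolding C_def by (simp flip: xs mset_append)
    then have "C \<subseteq># B" by (metis mset_subset_eq_add_left)
    have "size C = k - d" using B(2) xs by (auto simp: C_def)
    then have "Gcd (set_mset C) = 1" using assms(5) \<open>C \<subseteq># B\<close> B(1) by auto
    moreover have "Gcd (set_mset B) dvd Gcd (set_mset C)"
      using set_mset_mono[OF \<open>C \<subseteq># B\<close>] by (intro Gcd_greatest Gcd_dvd) auto
    ultimately show ?thesis by simp
  qed
  have "0 < real (prod_mset A)"
    using assms(1) by (auto intro!: Nat.gr0I simp: prod_mset_zero_iff)
  then show "\<forall>\<^sub>F n in sequentially. turan_inequality (\<lambda>m. real (partition_fun A m)) j n"
  proof (intro turan_inequality_if_differences_asymptotic)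
    fix i assume i: "i \<le> j"
    have "(\<lambda>n. (forward_difference ^^ i) (\<lambda>m. real (partition_fun A m)) n / real n ^ (k - 1 - i))
        \<longlonglongrightarrow> 1 / (real (prod_mset A) * fact (k - 1 - i))"
      using assms i j gcd by (intro partition_fun_difference_asymptotic) auto
    then show "(\<lambda>n. (forward_difference ^^ i) (\<lambda>m. real (partition_fun A m)) n / real n ^ (k - 1 - i))
        \<longlonglongrightarrow> (1 / real (prod_mset A)) / fact (k - 1 - i)"
      by simp
  qed (use assms(4) j in auto)
qed

end
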